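(* Consider the undisturbed system $x[n+1]=f(x[n],u[n])$ controlled by the successive linearization tube-based MPC algorithm described in the context. Assume initial feasibility at time $n=0$ and iteration $j=0$, i.e. a feasible trajectory $(\mathbf{x}^\circ,\mathbf{u}^\circ)$ with $x_0^\circ=x[0]$ as required in step 1 of the algorithm exists. Then the optimization problem (P) in the algorithm is feasible at all times $n>0$ and all iterations $j>0$.
   Context: **System and constraints.** $f:\mathbb{R}^{n_x}\times\mathbb{R}^{n_u}\to\mathbb{R}^{n_x}$ is differentiable. $\mathcal{X}\subset\mathbb{R}^{n_x}$ and $\mathcal{U}\subset\mathbb{R}^{n_u}$ are compact convex sets. $(x^r,u^r)$ is a constant reference. $Q\succeq0$, $R\succ0$, $\hat Q\succ0$ are weighting matrices, and $\lVert x\rVert_P=(x^\top Px)^{1/2}$. $N\ge1$ is the horizon. **Terminal parameters.** $\hat K$, $\hat Q\succ 0$, $\hat\gamma>0$ and $\hat{\mathcal{X}}=\{x:\lVert x-x^r\rVert_{\hat Q}^2\le\hat\gamma\}$ are such that $\hat{\mathcal{X}}\subseteq\mathcal{X}$, $\hat K(x-x^r)+u^r\in\mathcal{U}$ for all $x\in\hat{\mathcal{X}}$, and for all $x\in\hat{\mathcal{X}}$ $$\lVert x-x^r\rVert_{\hat Q}^2\ge\lVert f(x,\hat K(x-x^r)+u^r)-x^r\rVert_{\hat Q}^2+\lVert x-x^r\rVert_Q^2+\lVert\hat K(x-x^r)\rVert_R^2 .$$ **Tube.** A tube is $\boldsymbol{\mathcal{X}}=\{\mathcal{X}_k\}_{k=0}^N$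 with polytopic cross sections $\mathcal{X}_k=\{x:\Gamma x\le q_k\}$ and vertex set $\mathcal{V}(\mathcal{X}_k)$, in one of two parameterizations. (i) Elementwise bounds: $\Gamma=[I\ \ {-I}]^\top$, $q_k=[q_{2,k}^\top\ \ {-q_{1,k}^\top}]^\top$ with $q_{1,k},q_{2,k}\in\mathbb{R}^{n_x}$, and $\mathcal{V}(\mathcal{X}_k)$ consists of the $2^{n_x}$ points $\hat x$ with each $[\hat x]_l\in\{[q_{1,k}]_l,[q_{2,k}]_l\}$. (ii) Simplex: $\Gamma=[-I\ \ \mathbf 1]^\top$ ($\mathbf 1$ the vector of ones), $q_k=[\alpha_k^\top\ \ \beta_k]^\top$ with $\alpha_k\in\mathbb{R}^{n_x}$, $\beta_k\in\mathbb{R}$, $\sigma_k=\beta_k+\mathbf 1^\top\alpha_k$, and $\mathcal{V}(\mathcal{X}_k)=\{-\alpha_k,-\alpha_k+e_1\sigma_k,\dots,-\alpha_k+e_{n_x}\sigma_k\}$. Degenerate cross sections (single points) are allowed. **DC form.** $\Gamma f=g-h$, where all components of $g,h$ are convex functions of $(x,u)$ and $h$ is differentiable. Given a trajectory $(\mathbf{x}^\circ,\mathbf{u}^\circ)$, $\lfloor h^\circ\rfloor(x,u)$ denotes, at prediction step $k$, the first-order Taylor expansion of $h$ at $(x_k^\circ,u_k^\circ)$. **Feasible trajectory.** $(\mathbf{x}^\circ,\mathbf{u}^\circ)=(\{x_k^\circ\}_{k=0}^N,\{u_k^\circ\}_{k=0}^{N-1})$ with $x_{k+1}^\circ=f(x_k^\circ,u_k^\circ)$,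 $(x_k^\circ,u_k^\circ)\in\mathcal{X}\times\mathcal{U}$ for $k=0,\dots,N-1$, and $\lVert x_N^\circ-x^r\rVert_{\hat Q}^2\le\hat\gamma$. **Problem (P)** (given $(\mathbf{x}^\circ,\mathbf{u}^\circ)$ and gains $\{K_k\}_{k=0}^{N-1}$): minimize $\theta_N^2+\sum_{k=0}^{N-1}(\theta_k^2+\chi_k^2)$ over $\mathbf{v}=\{v_k\}_{k=0}^{N-1}$, the tube ($q_k$ and vertices $\mathcal{V}(\mathcal{X}_k)$, $k=0,\dots,N$), $\theta_k$ and $\chi_k$, subject to, for all $k\in\{0,\dots,N-1\}$ and all $\hat x_k\in\mathcal{V}(\mathcal{X}_k)$: $\lVert\hat x_k-x^r\rVert_Q\le\theta_k$; $\lVert v_k+K_k\hat x_k-u^r\rVert_R\le\chi_k$; $g(\hat x_k,v_k+K_k\hat x_k)-\lfloor h^\circ\rfloor(\hat x_k,v_k+K_k\hat x_k)\le q_{k+1}$ (componentwise); $\hat x_k\in\mathcal{X}$; $v_k+K_k\hat x_k\in\mathcal{U}$; and $\lVert\hat x_N-x^r\rVert_{\hat Q}\le\theta_N\le\sqrt{\hat\gamma}$ for all $\hat x_N\in\mathcal{V}(\mathcal{X}_N)$; and all vertices $\hat x_0$ of the initial cross section equal $x_0^\circ$. **Gains.** With $A_k=\frac{\partial f}{\partial x}(x_k^\circ,u_k^\circ)$, $B_k=\frac{\partial f}{\partial u}(x_k^\circ,u_k^\circ)$ and $P_N=\hat Q$, for $k=N-1,\dots,0$: $\Delta_k=B_k^\top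 P_{k+1}B_k+R$, $K_k=-\Delta_k^{-1}B_k^\top P_{k+1}A_k$, $P_k=Q+A_k^\top P_{k+1}A_k-A_k^\top P_{k+1}B_k\Delta_k^{-1}B_k^\top P_{k+1}A_k$. **Algorithm.** At each time $n=0,1,\dots$: 1. Set $x_0^\circ\leftarrow x[n]$. If $n=0$, find a feasible trajectory $(\mathbf{x}^\circ,\mathbf{u}^\circ)$ starting at $x_0^\circ$. If $n>0$, shift the last trajectory of time $n-1$: $u_k^\circ\leftarrow u_{k+1}^\circ$ and $x_{k+1}^\circ\leftarrow f(x_k^\circ,u_k^\circ)$ for $k=0,\dots,N-2$, then $u_{N-1}^\circ\leftarrow\hat K(x_{N-1}^\circ-x^r)+u^r$ and $x_N^\circ\leftarrow f(x_{N-1}^\circ,u_{N-1}^\circ)$. 2. For iterations $j=0,1,\dots$, until the change in objective is below a tolerance or a prescribed maximum number of iterations ($\ge 1$) is reached: linearize $h$ around $(\mathbf{x}^\circ,\mathbf{u}^\circ)$; compute $\{K_k\}$; solve (P) to obtain $(\mathbf{v},\boldsymbol{\mathcal{X}})$; update, for $k=0,\dots,N-1$, $u_k^\circ\leftarrow v_k+K_kx_k^\circ$, $x_{k+1}^\circ\leftarrow f(x_k^\circ,u_k^\circ)$ (with $x_0^\circ$ unchanged); record the optimal objective value $J^{j,n}$. 3. Apply $u[n]=u_0^\circ$. *)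

theory Defs
  imports "HOL-Analysis.Analysis"
begin

definition pos_semidef :: "real^'n^'n \<Rightarrow> bool" where
  "pos_semidef P \<longleftrightarrow> transpose P = P \<and> (\<forall>x. 0 \<le> x \<bullet> (P *v x))"

definition pos_def :: "real^'n^'n \<Rightarrow> bool" where
  "pos_def P \<longleftrightarrow> transpose P = P \<and> (\<forall>x. x \<noteq> 0 \<longrightarrow> 0 < x \<bullet> (P *v x))"

definition wnorm :: "real^'n^'n \<Rightarrow> real^'n \<Rightarrow> real" where
  "wnorm P x = sqrt (x \<bullet> (P *v x))"

record ('n, 'm) mpc =
  dyn :: "(real^'n::finite) \<times> (real^'m::finite) \<Rightarrow> real^'n"
  Xset :: "(real^'n) set"
  Uset :: "(real^'m) set"
  xref :: "real^'n"
  uref :: "real^'m"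
  Qx :: "real^'n^'n"
  Ru :: "real^'m^'m"
  horizon :: nat
  Qhat :: "real^'n^'n"
  Khat :: "real^'n^'m"
  gamhat :: real

definition terminal_set :: "('n::finite, 'm::finite) mpc \<Rightarrow> (real^'n) set" where
  "terminal_set S = {x. (wnorm (Qhat S) (x - xref S))\<^sup>2 \<le> gamhat S}"

definition terminal_law :: "('n::finite, 'm::finite) mpc \<Rightarrow> real^'n \<Rightarrow> real^'m" where
  "terminal_law S x = Khat S *v (x - xref S) + uref S"

text \<open>Trajectories are sequences on \<^typ>\<open>nat\<close>; only the states with index at most
  \<^const>\<open>horizon\<close> and the inputs with index below it are meaningful.\<close>

definition feasible_trajectory ::
  "('n::finite, 'm::finite) mpc \<Rightarrow> (nat \<Rightarrow> real^'n) \<Rightarrow> (nat \<Rightarrow> real^'m) \<Rightarrow> bool" where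
  "feasible_trajectory S xs us \<longleftrightarrow>
     (\<forall>k<horizon S. xs (Suc k) = dyn S (xs k, us k) \<and> xs k \<in> Xset S \<and> us k \<in> Uset S) \<and>
     (wnorm (Qhat S) (xs (horizon S) - xref S))\<^sup>2 \<le> gamhat S"

text \<open>A cross section is \<open>{x. \<Gamma> *v x \<le> q}\<close>, with the componentwise order on vectors.
  The rows of \<open>\<Gamma>\<close> are indexed by a sum type that mirrors its block structure.
  The vertex sets are functions of \<open>q\<close>.\<close>

text \<open>Elementwise bounds: \<open>q $ Inl l\<close> is the upper bound and \<open>- q $ Inr l\<close> the lower bound on
  component \<open>l\<close>.\<close>

definition box_Gamma :: "real^'n^('n::finite + 'n)" where
  "box_Gamma = (\<chi> r. case r of Inl l \<Rightarrow> axis l 1 | Inr l \<Rightarrow> - axis l 1)"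

definition box_vertices :: "real^('n::finite + 'n) \<Rightarrow> (real^'n) set" where
  "box_vertices q = {x. \<forall>l. x $ l \<in> {- q $ Inr l, q $ Inl l}}"

text \<open>Simplex: \<open>\<alpha>\<close> consists of the components \<open>q $ Inl l\<close>, and \<open>\<beta> = q $ Inr ()\<close>.\<close>

definition simplex_Gamma :: "real^'n^('n::finite + unit)" where
  "simplex_Gamma = (\<chi> r. case r of Inl l \<Rightarrow> - axis l 1 | Inr _ \<Rightarrow> (\<chi> i. 1))"

definition simplex_vertices :: "real^('n::finite + unit) \<Rightarrow> (real^'n) set" where
  "simplex_vertices q =
     (let \<alpha> = (\<chi> l. q $ Inl l); \<beta> = q $ Inr (); \<sigma> = \<beta> + (\<Sum>l\<in>UNIV. \<alpha> $ l)
      in insert (- \<alpha>) (range (\<lambda>l. - \<alpha> + \<sigma> *\<^sub>R axis l 1)))"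

definition dc_form ::
  "real^'n^'r \<Rightarrow> ((real^'n) \<times> (real^'m) \<Rightarrow> real^'n) \<Rightarrow>
   ((real^'n) \<times> (real^'m) \<Rightarrow> real^'r) \<Rightarrow> ((real^'n) \<times> (real^'m) \<Rightarrow> real^'r) \<Rightarrow> bool" where
  "dc_form \<Gamma> f g h \<longleftrightarrow>
     (\<forall>z. \<Gamma> *v f z = g z - h z) \<and>
     (\<forall>i. convex_on UNIV (\<lambda>z. g z $ i)) \<and>
     (\<forall>i. convex_on UNIV (\<lambda>z. h z $ i)) \<and>
     h differentiable_on UNIV"

definition taylor1 ::
  "((real^'n) \<times> (real^'m) \<Rightarrow> real^'r) \<Rightarrow> (real^'n) \<times> (real^'m) \<Rightarrow> (real^'n) \<times> (real^'m) \<Rightarrow> real^'r"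
  where
  "taylor1 h z0 z = h z0 + frechet_derivative h (at z0) (z - z0)"

definition A_mat ::
  "('n::finite, 'm::finite) mpc \<Rightarrow> (nat \<Rightarrow> real^'n) \<Rightarrow> (nat \<Rightarrow> real^'m) \<Rightarrow> nat \<Rightarrow> real^'n^'n" where
  "A_mat S xs us k = jacobian (\<lambda>x. dyn S (x, us k)) (at (xs k))"

definition B_mat ::
  "('n::finite, 'm::finite) mpc \<Rightarrow> (nat \<Rightarrow> real^'n) \<Rightarrow> (nat \<Rightarrow> real^'m) \<Rightarrow> nat \<Rightarrow> real^'m^'n" where
  "B_mat S xs us k = jacobian (\<lambda>u. dyn S (xs k, u)) (at (us k))"

definition Delta_mat :: "real^'m^'m \<Rightarrow> real^'m^'n \<Rightarrow> real^'n^'n \<Rightarrow> real^'m^'m" where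
  "Delta_mat R B P = transpose B ** P ** B + R"

text \<open>The recursion runs backwards in time: \<open>riccati S xs us i\<close> is the matrix \<open>P\<close>
  with index \<open>horizon S - i\<close>.\<close>

primrec riccati ::
  "('n::finite, 'm::finite) mpc \<Rightarrow> (nat \<Rightarrow> real^'n) \<Rightarrow> (nat \<Rightarrow> real^'m) \<Rightarrow> nat \<Rightarrow> real^'n^'n" where
  "riccati S xs us 0 = Qhat S"
| "riccati S xs us (Suc i) =
     (let k = horizon S - Suc i; A = A_mat S xs us k; B = B_mat S xs us k; P = riccati S xs us i
      in Qx S + transpose A ** P ** A
         - transpose A ** P ** B ** matrix_inv (Delta_mat (Ru S) B P) ** transpose B ** P ** A)"

definition gain ::
  "('n::finite, 'm::finite) mpc \<Rightarrow> (nat \<Rightarrow> real^'n) \<Rightarrow> (nat \<Rightarrow> real^'m) \<Rightarrow> nat \<Rightarrow> real^'n^'m" where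
  "gain S xs us k =
     (let A = A_mat S xs us k; B = B_mat S xs us k; P = riccati S xs us (horizon S - Suc k)
      in - (matrix_inv (Delta_mat (Ru S) B P) ** transpose B ** P ** A))"

text \<open>\<open>V\<close> is the vertex map of the chosen tube parameterization, \<open>(xs, us)\<close> the trajectory around
  which \<open>h\<close> is linearized, \<open>K\<close> the gains, and \<open>(v, q, \<theta>, \<phi>)\<close> the decision variables: \<open>\<theta>\<close> bounds the
  state cost and \<open>\<phi>\<close> the input cost.\<close>

definition constraints ::
  "('n::finite, 'm::finite) mpc \<Rightarrow> (real^'r \<Rightarrow> (real^'n) set) \<Rightarrow>
   ((real^'n) \<times> (real^'m) \<Rightarrow> real^'r) \<Rightarrow> ((real^'n) \<times> (real^'m) \<Rightarrow> real^'r) \<Rightarrow>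
   (nat \<Rightarrow> real^'n) \<Rightarrow> (nat \<Rightarrow> real^'m) \<Rightarrow> (nat \<Rightarrow> real^'n^'m) \<Rightarrow>
   (nat \<Rightarrow> real^'m) \<Rightarrow> (nat \<Rightarrow> real^'r) \<Rightarrow> (nat \<Rightarrow> real) \<Rightarrow> (nat \<Rightarrow> real) \<Rightarrow> bool" where
  "constraints S V g h xs us K v q \<theta> \<phi> \<longleftrightarrow>
     (\<forall>k<horizon S. \<forall>x\<in>V (q k). (let u = v k + K k *v x in
        wnorm (Qx S) (x - xref S) \<le> \<theta> k \<and>
        wnorm (Ru S) (u - uref S) \<le> \<phi> k \<and>
        g (x, u) - taylor1 h (xs k, us k) (x, u) \<le> q (Suc k) \<and>
        x \<in> Xset S \<and> u \<in> Uset S)) \<and>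
     (\<forall>x\<in>V (q (horizon S)). wnorm (Qhat S) (x - xref S) \<le> \<theta> (horizon S)) \<and>
     \<theta> (horizon S) \<le> sqrt (gamhat S) \<and>
     (\<forall>x\<in>V (q 0). x = xs 0)"

definition problem_feasible ::
  "('n::finite, 'm::finite) mpc \<Rightarrow> (real^'r \<Rightarrow> (real^'n) set) \<Rightarrow>
   ((real^'n) \<times> (real^'m) \<Rightarrow> real^'r) \<Rightarrow> ((real^'n) \<times> (real^'m) \<Rightarrow> real^'r) \<Rightarrow>
   (nat \<Rightarrow> real^'n) \<Rightarrow> (nat \<Rightarrow> real^'m) \<Rightarrow> (nat \<Rightarrow> real^'n^'m) \<Rightarrow> bool" where
  "problem_feasible S V g h xs us K \<longleftrightarrow> (\<exists>v q \<theta> \<phi>. constraints S V g h xs us K v q \<theta> \<phi>)"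

definition objective ::
  "('n::finite, 'm::finite) mpc \<Rightarrow> (nat \<Rightarrow> real) \<Rightarrow> (nat \<Rightarrow> real) \<Rightarrow> real" where
  "objective S \<theta> \<phi> = (\<theta> (horizon S))\<^sup>2 + (\<Sum>k<horizon S. (\<theta> k)\<^sup>2 + (\<phi> k)\<^sup>2)"

definition optimal ::
  "('n::finite, 'm::finite) mpc \<Rightarrow> (real^'r \<Rightarrow> (real^'n) set) \<Rightarrow>
   ((real^'n) \<times> (real^'m) \<Rightarrow> real^'r) \<Rightarrow> ((real^'n) \<times> (real^'m) \<Rightarrow> real^'r) \<Rightarrow>
   (nat \<Rightarrow> real^'n) \<Rightarrow> (nat \<Rightarrow> real^'m) \<Rightarrow> (nat \<Rightarrow> real^'n^'m) \<Rightarrow>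
   (nat \<Rightarrow> real^'m) \<Rightarrow> (nat \<Rightarrow> real^'r) \<Rightarrow> (nat \<Rightarrow> real) \<Rightarrow> (nat \<Rightarrow> real) \<Rightarrow> bool" where
  "optimal S V g h xs us K v q \<theta> \<phi> \<longleftrightarrow>
     constraints S V g h xs us K v q \<theta> \<phi> \<and>
     (\<forall>v' q' \<theta>' \<phi>'. constraints S V g h xs us K v' q' \<theta>' \<phi>' \<longrightarrow>
        objective S \<theta> \<phi> \<le> objective S \<theta>' \<phi>')"

text \<open>State sequence from \<open>x0\<close> under the time-varying feedback law \<open>\<pi>\<close>, and its inputs.\<close>

primrec roll_states ::
  "((real^'n) \<times> (real^'m) \<Rightarrow> real^'n) \<Rightarrow> (nat \<Rightarrow> real^'n \<Rightarrow> real^'m) \<Rightarrow> real^'n \<Rightarrow> nat \<Rightarrow> real^'n"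
  where
  "roll_states f \<pi> x0 0 = x0"
| "roll_states f \<pi> x0 (Suc k) = f (roll_states f \<pi> x0 k, \<pi> k (roll_states f \<pi> x0 k))"

definition roll_inputs ::
  "((real^'n) \<times> (real^'m) \<Rightarrow> real^'n) \<Rightarrow> (nat \<Rightarrow> real^'n \<Rightarrow> real^'m) \<Rightarrow> real^'n \<Rightarrow> nat \<Rightarrow> real^'m"
  where
  "roll_inputs f \<pi> x0 k = \<pi> k (roll_states f \<pi> x0 k)"

definition tube_law ::
  "(nat \<Rightarrow> real^'m) \<Rightarrow> (nat \<Rightarrow> real^'n^'m) \<Rightarrow> nat \<Rightarrow> real^'n \<Rightarrow> real^'m" where
  "tube_law v K k x = v k + K k *v x"

definition shift_law ::
  "('n::finite, 'm::finite) mpc \<Rightarrow> (nat \<Rightarrow> real^'m) \<Rightarrow> nat \<Rightarrow> real^'n \<Rightarrow> real^'m" where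
  "shift_law S us k x = (if Suc k < horizon S then us (Suc k) else terminal_law S x)"

text \<open>Termination test after iteration \<open>j\<close>: \<open>Jp\<close> is the objective of the preceding iteration at the
  same time step, if any, and \<open>J\<close> the one just obtained.\<close>

definition stop :: "real \<Rightarrow> nat \<Rightarrow> nat \<Rightarrow> real option \<Rightarrow> real \<Rightarrow> bool" where
  "stop tol jmax j Jp J \<longleftrightarrow>
     jmax \<le> Suc j \<or> (case Jp of None \<Rightarrow> False | Some J' \<Rightarrow> \<bar>J' - J\<bar> < tol)"

text \<open>\<open>poses \<dots> n j x xs us Jp\<close>: some execution of the algorithm from the plant state \<open>x_init\<close> at time
  0 reaches iteration \<open>j\<close> of time \<open>n\<close>, where the plant is in state \<open>x\<close>, and there poses the
  optimization problem for the trajectory \<open>(xs, us)\<close>. An execution can continue past this point only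
  with an optimal solution of that problem. In \<open>next_time\<close>, the plant moves under the
  input \<open>us' 0\<close>.\<close>

inductive poses ::
  "('n::finite, 'm::finite) mpc \<Rightarrow> (real^'r \<Rightarrow> (real^'n) set) \<Rightarrow>
   ((real^'n) \<times> (real^'m) \<Rightarrow> real^'r) \<Rightarrow> ((real^'n) \<times> (real^'m) \<Rightarrow> real^'r) \<Rightarrow>
   real \<Rightarrow> nat \<Rightarrow> real^'n \<Rightarrow>
   nat \<Rightarrow> nat \<Rightarrow> real^'n \<Rightarrow> (nat \<Rightarrow> real^'n) \<Rightarrow> (nat \<Rightarrow> real^'m) \<Rightarrow> real option \<Rightarrow> bool"
  for S V g h tol jmax x_init where
  start:
    "\<lbrakk> feasible_trajectory S xs us; xs 0 = x_init \<rbrakk>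
     \<Longrightarrow> poses S V g h tol jmax x_init 0 0 x_init xs us None"
| next_iteration:
    "\<lbrakk> poses S V g h tol jmax x_init n j x xs us Jp;
       K = gain S xs us;
       optimal S V g h xs us K v q \<theta> \<phi>;
       \<not> stop tol jmax j Jp (objective S \<theta> \<phi>);
       xs' = roll_states (dyn S) (tube_law v K) (xs 0);
       us' = roll_inputs (dyn S) (tube_law v K) (xs 0) \<rbrakk>
     \<Longrightarrow> poses S V g h tol jmax x_init n (Suc j) x xs' us' (Some (objective S \<theta> \<phi>))"
| next_time:
    "\<lbrakk> poses S V g h tol jmax x_init n j x xs us Jp;
       K = gain S xs us;
       optimal S V g h xs us K v q \<theta> \<phi>;
       stop tol jmax j Jp (objective S \<theta> \<phi>);
       us' = roll_inputs (dyn S) (tube_law v K) (xs 0);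
       x' = dyn S (x, us' 0);
       xs'' = roll_states (dyn S) (shift_law S us') x';
       us'' = roll_inputs (dyn S) (shift_law S us') x' \<rbrakk>
     \<Longrightarrow> poses S V g h tol jmax x_init (Suc n) 0 x' xs'' us'' None"

end

theory Submission
  imports Defs
begin

text \<open>
  Recursive feasibility holds because every problem that the algorithm poses is linearized around
  a feasible trajectory, and a feasible trajectory always supplies a feasible point.

  The feasible point is the tube that has shrunk to the trajectory itself, with the feedforward term
  chosen such that the feedback law reproduces the given inputs. There the linearization of \<open>h\<close> is
  exact, so the tube constraint is the dynamics, written as \<open>\<Gamma> f = g - h\<close>
  (\<open>feasible_trajectory_imp_problem_feasible\<close>).

  Feasibility of the trajectory survives both ways of updating it.

  \<^item> After an iteration, the new trajectory is the closed-loop response to the computed feedback law.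
    It stays in the tube: a constraint imposed at the vertices of a cross section extends to their
    convex hull, since \<open>g\<close> minus an affine function is convex, and replacing \<open>h\<close> by its Taylor
    expansion only enlarges \<open>g - h\<close>, since a convex function lies above its tangents. So the constraints
    on vertices, all of them convex, hold along the response
    (\<open>constraints_imp_feasible_roll\<close>).

  \<^item> After a time step, the tail of the trajectory is extended by one step under the terminal law.
    The terminal inequality makes the terminal set invariant under this law
    (\<open>feasible_trajectory_shift\<close>).

  The tube parameterization enters only through three properties of its vertices, collected in
  \<open>vertex_map\<close>.
\<close>

section \<open>Convexity of the constraints\<close>

text \<open>The gradient inequality for a convex function of several variables is the one-dimensional
  tangent inequality on the line through \<open>z0\<close> and \<open>z\<close>.\<close>

lemma taylor1_le_convex:
  fixes h :: "(real^'n) \<times> (real^'m) \<Rightarrow> real^'r"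
  assumes "convex_on UNIV (\<lambda>z. h z $ i)" "h differentiable (at z0)"
  shows "taylor1 h z0 z $ i \<le> h z $ i"
proof -
  define D where "D = frechet_derivative h (at z0)"
  define \<phi> where "\<phi> = (\<lambda>t::real. h (z0 + t *\<^sub>R (z - z0)) $ i)"
  have D: "(h has_derivative D) (at z0)"
    using assms(2) D_def frechet_derivative_works by blast
  interpret D: bounded_linear D using D by (rule has_derivative_bounded_linear)
  have "convex_on UNIV \<phi>"
  proof (rule convex_onI)
    fix t x y :: real assume t: "0 < t" "t < 1"
    have eq: "z0 + ((1 - t) *\<^sub>R x + t *\<^sub>R y) *\<^sub>R (z - z0)
      = (1 - t) *\<^sub>R (z0 + x *\<^sub>R (z - z0)) + t *\<^sub>R (z0 + y *\<^sub>R (z - z0))"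
      by (simp add: algebra_simps)
    show "\<phi> ((1 - t) *\<^sub>R x + t *\<^sub>R y) \<le> (1 - t) * \<phi> x + t * \<phi> y"
      unfolding \<phi>_def eq using convex_onD[OF assms(1)] t by simp
  qed simp
  moreover have "(\<phi> has_field_derivative D (z - z0) $ i) (at 0 within UNIV)"
  proof -
    have "((\<lambda>t::real. h (z0 + t *\<^sub>R (z - z0))) has_derivative (\<lambda>t. D (t *\<^sub>R (z - z0)))) (at 0)"
      by (rule has_derivative_compose[where g = h]) (auto intro!: derivative_eq_intros simp: D)
    then have "(\<phi> has_derivative (\<lambda>t. D (t *\<^sub>R (z - z0)) $ i)) (at 0)"
      unfolding \<phi>_def by (rule bounded_linear.has_derivative[OF bounded_linear_vec_nth])
    then show ?thesis
      unfolding has_field_derivative_def by (simp add: D.scaleR mult.commute[of _ "D _ $ i"])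
  qed
  ultimately have "\<phi> 1 - \<phi> 0 \<ge> D (z - z0) $ i * (1 - 0)"
    by (intro convex_on_imp_above_tangent[where A = UNIV]) auto
  then show ?thesis by (simp add: \<phi>_def taylor1_def D_def)
qed

text \<open>The Taylor expansion is affine, so subtracting it from \<open>g\<close> preserves convexity.\<close>

lemma convex_dc_sublevel:
  fixes g h :: "(real^'n) \<times> (real^'m) \<Rightarrow> real^'r"
  assumes g: "\<And>i. convex_on UNIV (\<lambda>z. g z $ i)" and h: "h differentiable (at z0)"
  shows "convex {z. g z - taylor1 h z0 z \<le> q}"
proof (rule convexI)
  fix z w and s t :: real
  assume zw: "z \<in> {z. g z - taylor1 h z0 z \<le> q}" "w \<in> {z. g z - taylor1 h z0 z \<le> q}"
    and st: "0 \<le> s" "0 \<le> t" "s + t = 1"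
  interpret D: bounded_linear "frechet_derivative h (at z0)"
    using h frechet_derivative_works has_derivative_bounded_linear by blast
  have s: "s = 1 - t" using st by simp
  have "s *\<^sub>R z + t *\<^sub>R w - z0 = s *\<^sub>R (z - z0) + t *\<^sub>R (w - z0)"
    by (simp add: s algebra_simps)
  moreover have "h z0 = s *\<^sub>R h z0 + t *\<^sub>R h z0"
    by (simp add: s algebra_simps)
  ultimately have T: "taylor1 h z0 (s *\<^sub>R z + t *\<^sub>R w) = s *\<^sub>R taylor1 h z0 z + t *\<^sub>R taylor1 h z0 w"
    by (simp add: taylor1_def D.add D.scaleR scaleR_add_right)
  have "(g (s *\<^sub>R z + t *\<^sub>R w) - taylor1 h z0 (s *\<^sub>R z + t *\<^sub>R w)) $ i \<le> q $ i" for i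
  proof -
    have "g (s *\<^sub>R z + t *\<^sub>R w) $ i \<le> s * g z $ i + t * g w $ i"
      using convex_onD[OF g, of t z w i] st by (simp add: s)
    moreover have "s * (g z $ i - taylor1 h z0 z $ i) + t * (g w $ i - taylor1 h z0 w $ i)
        \<le> s * q $ i + t * q $ i"
      using zw st by (intro add_mono mult_left_mono) (auto simp: less_eq_vec_def)
    moreover have "s * q $ i + t * q $ i = q $ i"
      by (simp add: s algebra_simps)
    ultimately show ?thesis by (simp add: T right_diff_distrib)
  qed
  then show "s *\<^sub>R z + t *\<^sub>R w \<in> {z. g z - taylor1 h z0 z \<le> q}"
    by (simp add: less_eq_vec_def)
qed

text \<open>Pairing a state with its input under affine feedback is an affine map. A convex constraint on
  state and input together is therefore a convex constraint on the state.\<close>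

lemma convex_feedback_vimage:
  fixes K :: "real^'n^'m"
  assumes "convex C"
  shows "convex {x. (x, v + K *v x) \<in> C}"
proof (rule convexI)
  fix x y and s t :: real
  assume *: "x \<in> {x. (x, v + K *v x) \<in> C}" "y \<in> {x. (x, v + K *v x) \<in> C}" "0 \<le> s" "0 \<le> t" "s + t = 1"
  have "(s *\<^sub>R x + t *\<^sub>R y, v + K *v (s *\<^sub>R x + t *\<^sub>R y)) = s *\<^sub>R (x, v + K *v x) + t *\<^sub>R (y, v + K *v y)"
  proof -
    have "v = s *\<^sub>R v + t *\<^sub>R v" using * by (metis scaleR_add_left scaleR_one)
    then show ?thesis
      by (simp add: matrix_vector_right_distrib matrix_vector_mult_scaleR algebra_simps)
  qed
  then show "s *\<^sub>R x + t *\<^sub>R y \<in> {x. (x, v + K *v x) \<in> C}"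
    using convexD[OF assms, of "(x, v + K *v x)" "(y, v + K *v y)" s t] * by simp
qed

text \<open>For a quadratic form, the gap in the convexity inequality is \<open>s * t\<close> times the form at the
  difference of the two points.\<close>

lemma convex_ellipsoid:
  fixes P :: "real^'n^'n"
  assumes "pos_semidef P"
  shows "convex {x. (x - c) \<bullet> (P *v (x - c)) \<le> r}"
proof (rule convexI)
  fix x y and s t :: real
  assume *: "x \<in> {x. (x - c) \<bullet> (P *v (x - c)) \<le> r}" "y \<in> {x. (x - c) \<bullet> (P *v (x - c)) \<le> r}"
    "0 \<le> s" "0 \<le> t" "s + t = 1"
  define a where "a = x - c"
  define b where "b = y - c"
  have s: "s = 1 - t" using * by simp
  have "s *\<^sub>R x + t *\<^sub>R y - c = s *\<^sub>R a + t *\<^sub>R b"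
    by (simp add: s a_def b_def algebra_simps)
  moreover have "(s *\<^sub>R a + t *\<^sub>R b) \<bullet> (P *v (s *\<^sub>R a + t *\<^sub>R b))
      = s * (a \<bullet> (P *v a)) + t * (b \<bullet> (P *v b)) - s * t * ((a - b) \<bullet> (P *v (a - b)))"
    by (simp add: s matrix_vector_right_distrib matrix_vector_mult_diff_distrib
        matrix_vector_mult_scaleR inner_simps algebra_simps)
  moreover have "0 \<le> s * t * ((a - b) \<bullet> (P *v (a - b)))"
    using assms * by (simp add: pos_semidef_def)
  moreover have "s * (a \<bullet> (P *v a)) + t * (b \<bullet> (P *v b)) \<le> s * r + t * r"
    using * by (intro add_mono mult_left_mono) (auto simp: a_def b_def)
  moreover have "s * r + t * r = r" by (simp add: s algebra_simps)
  ultimately show "s *\<^sub>R x + t *\<^sub>R y \<in> {x. (x - c) \<bullet> (P *v (x - c)) \<le> r}"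
    by simp
qed

lemma pos_def_imp_pos_semidef: "pos_def P \<Longrightarrow> pos_semidef P"
  unfolding pos_def_def pos_semidef_def by (metis inner_zero_left less_eq_real_def)

lemma wnorm_square: "pos_semidef P \<Longrightarrow> (wnorm P x)\<^sup>2 = x \<bullet> (P *v x)"
  by (simp add: wnorm_def pos_semidef_def)

lemma wnorm_le_sqrt_iff: "pos_semidef P \<Longrightarrow> wnorm P x \<le> sqrt c \<longleftrightarrow> (wnorm P x)\<^sup>2 \<le> c"
  by (simp add: wnorm_square) (simp add: wnorm_def)

lemma convex_terminal_set: "pos_semidef (Qhat S) \<Longrightarrow> convex (terminal_set S)"
  unfolding terminal_set_def by (simp add: wnorm_square convex_ellipsoid)

section \<open>Tube parameterizations and their vertices\<close>

text \<open>The hull condition is one inclusion only: the listed vertices need not satisfy the inequalities,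
  and they do not if the cross section is empty (reversed bounds in a box, negative \<open>\<sigma>\<close> in a simplex).
  Nonemptiness of \<open>V q\<close> makes the condition on the initial vertices fix the initial cross section. The
  last condition says that every single point is a degenerate cross section.\<close>

definition vertex_map :: "real^'n^'r \<Rightarrow> (real^'r \<Rightarrow> (real^'n) set) \<Rightarrow> bool" where
  "vertex_map \<Gamma> V \<longleftrightarrow>
     (\<forall>q. V q \<noteq> {}) \<and>
     (\<forall>q x. \<Gamma> *v x \<le> q \<longrightarrow> x \<in> convex hull V q) \<and>
     (\<forall>x. V (\<Gamma> *v x) = {x})"

lemma box_Gamma_mult:
  "(box_Gamma *v x) $ Inl l = x $ l" "(box_Gamma *v x) $ Inr l = - x $ l"
  by (simp_all add: box_Gamma_def matrix_vector_mul_component inner_axis' inner_minus_left)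

lemma simplex_Gamma_mult:
  "(simplex_Gamma *v x) $ Inl l = - x $ l" "(simplex_Gamma *v x) $ Inr () = (\<Sum>l\<in>UNIV. x $ l)"
  by (simp_all add: simplex_Gamma_def matrix_vector_mul_component inner_axis' inner_minus_left)
    (simp add: inner_vec_def)

text \<open>Coordinates are released one at a time: \<open>L\<close> collects those where \<open>x\<close> need not be at
  a bound. Moving one of them to its two bounds gives two points whose segment contains \<open>x\<close>.\<close>

lemma mem_hull_corners:
  fixes a b x :: "real^'n"
  assumes "\<And>l. a $ l \<le> x $ l \<and> x $ l \<le> b $ l"
  shows "x \<in> convex hull {x. \<forall>l. x $ l \<in> {a $ l, b $ l}}" (is "_ \<in> convex hull ?V")
proof -
  have "finite L \<Longrightarrow> (\<forall>l. l \<notin> L \<longrightarrow> x $ l \<in> {a $ l, b $ l}) \<Longrightarrow>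
      (\<forall>l. a $ l \<le> x $ l \<and> x $ l \<le> b $ l) \<Longrightarrow> x \<in> convex hull ?V" for L and x :: "real^'n"
  proof (induction L arbitrary: x rule: finite_induct)
    case empty
    then show ?case by (intro hull_inc) simp
  next
    case (insert m L)
    define y where "y = (\<lambda>c. \<chi> l. if l = m then c else x $ l)"
    have "a $ m \<le> b $ m" using insert.prems(2) order_trans by blast
    then have y: "y c \<in> convex hull ?V" if "c \<in> {a $ m, b $ m}" for c
      using insert.prems that by (intro insert.IH) (auto simp: y_def)
    have "x $ m \<in> closed_segment (a $ m) (b $ m)"
      using insert.prems(2) \<open>a $ m \<le> b $ m\<close> by (simp add: closed_segment_eq_real_ivl)
    then obtain t where t: "0 \<le> t" "t \<le> 1" "x $ m = (1 - t) *\<^sub>R a $ m + t *\<^sub>R b $ m"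
      unfolding closed_segment_def by auto
    then have "x = (1 - t) *\<^sub>R y (a $ m) + t *\<^sub>R y (b $ m)"
      by (simp add: vec_eq_iff y_def algebra_simps)
    then show ?case
      using convexD[OF convex_convex_hull, OF y y, of "a $ m" "b $ m" "1 - t" t] t by simp
  qed
  from this[of UNIV] show ?thesis using assms by simp
qed

lemma box_vertex_map: "vertex_map box_Gamma box_vertices"
  unfolding vertex_map_def
proof (intro conjI allI impI)
  fix q :: "real^('n::finite + 'n)"
  have "(\<chi> l. q $ Inl l) \<in> box_vertices q" by (simp add: box_vertices_def)
  then show "box_vertices q \<noteq> {}" by blast
next
  fix q :: "real^('n::finite + 'n)" and x :: "real^'n"
  assume "box_Gamma *v x \<le> q"
  then have "- q $ Inr l \<le> x $ l \<and> x $ l \<le> q $ Inl l" for l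
    unfolding less_eq_vec_def by (metis box_Gamma_mult minus_le_iff)
  then show "x \<in> convex hull box_vertices q"
    using mem_hull_corners[of "\<chi> l. - q $ Inr l" x "\<chi> l. q $ Inl l"] by (simp add: box_vertices_def)
next
  show "box_vertices (box_Gamma *v x) = {x}" for x :: "real^'n"
    by (auto simp: box_vertices_def box_Gamma_mult vec_eq_iff)
qed

text \<open>The barycentric coordinates of \<open>x\<close> are \<open>(x\<^sub>l + \<alpha>\<^sub>l) / \<sigma>\<close> at the vertex \<open>-\<alpha> + \<sigma> e\<^sub>l\<close>, and what
  remains to 1 at \<open>-\<alpha>\<close>. The inequalities say exactly that these are nonnegative. If \<open>\<sigma> = 0\<close>, then
  the simplex is the point \<open>-\<alpha>\<close>.\<close>

lemma simplex_vertex_map: "vertex_map simplex_Gamma simplex_vertices"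
  unfolding vertex_map_def
proof (intro conjI allI impI)
  show "simplex_vertices q \<noteq> {}" for q :: "real^('n::finite + unit)"
    by (simp add: simplex_vertices_def Let_def)
next
  fix q :: "real^('n::finite + unit)" and x :: "real^'n"
  assume *: "simplex_Gamma *v x \<le> q"
  define \<alpha> where "\<alpha> = (\<chi> l. q $ Inl l)"
  define \<sigma> where "\<sigma> = q $ Inr () + (\<Sum>l\<in>UNIV. \<alpha> $ l)"
  have V: "simplex_vertices q = insert (- \<alpha>) (range (\<lambda>l. - \<alpha> + \<sigma> *\<^sub>R axis l 1))"
    by (simp add: simplex_vertices_def Let_def \<alpha>_def \<sigma>_def)
  have nonneg: "0 \<le> x $ l + \<alpha> $ l" for l
  proof -
    have "(simplex_Gamma *v x) $ Inl l \<le> q $ Inl l" using * by (simp add: less_eq_vec_def)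
    then show ?thesis by (simp add: simplex_Gamma_mult \<alpha>_def)
  qed
  have "(simplex_Gamma *v x) $ Inr () \<le> q $ Inr ()" using * by (simp add: less_eq_vec_def)
  then have sum_le: "(\<Sum>l\<in>UNIV. x $ l + \<alpha> $ l) \<le> \<sigma>"
    by (simp add: simplex_Gamma_mult \<sigma>_def sum.distrib)
  show "x \<in> convex hull simplex_vertices q"
  proof (cases "\<sigma> = 0")
    case True
    then have "x $ l + \<alpha> $ l = 0" for l
      using sum_le nonneg sum_nonneg_eq_0_iff[of UNIV "\<lambda>l. x $ l + \<alpha> $ l"]
        sum_nonneg[of UNIV "\<lambda>l. x $ l + \<alpha> $ l"] by simp
    then have "x = - \<alpha>" by (simp add: vec_eq_iff eq_neg_iff_add_eq_0)
    then show ?thesis by (intro hull_inc) (simp add: V)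
  next
    case False
    then have \<sigma>: "0 < \<sigma>"
      using sum_le sum_nonneg[of UNIV "\<lambda>l. x $ l + \<alpha> $ l"] nonneg by simp
    define t where "t = (\<lambda>l. (x $ l + \<alpha> $ l) / \<sigma>)"
    \<comment> \<open>The vertices are indexed by \<open>'n option\<close>, with \<open>None\<close> for the vertex \<open>-\<alpha>\<close>.\<close>
    define w where "w = case_option (1 - (\<Sum>l\<in>UNIV. t l)) t"
    define p where "p = case_option (- \<alpha>) (\<lambda>l. - \<alpha> + \<sigma> *\<^sub>R axis l 1)"
    have split: "sum F UNIV = F None + (\<Sum>l\<in>UNIV. F (Some l))" for F :: "'n option \<Rightarrow> 'z::comm_monoid_add"
      by (simp add: UNIV_option_conv sum.reindex)
    have "sum t UNIV = (\<Sum>l\<in>UNIV. x $ l + \<alpha> $ l) / \<sigma>"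
      by (simp add: t_def sum_divide_distrib)
    then have "sum t UNIV \<le> 1" using sum_le \<sigma> by simp
    then have "(\<Sum>i\<in>UNIV. w i *\<^sub>R p i) \<in> convex hull simplex_vertices q"
      using nonneg \<sigma>
      by (intro convex_sum)
        (auto simp: split w_def p_def t_def V intro: hull_inc split: option.split)
    moreover have "(\<Sum>i\<in>UNIV. w i *\<^sub>R p i) = x"
    proof -
      have "(\<Sum>i\<in>UNIV. w i *\<^sub>R p i) = - \<alpha> + (\<Sum>l\<in>UNIV. (t l * \<sigma>) *\<^sub>R axis l 1)"
        by (simp add: split w_def p_def algebra_simps sum.distrib sum_subtractf
            flip: scaleR_sum_left)
      also have "(\<Sum>l\<in>UNIV. (t l * \<sigma>) *\<^sub>R axis l 1) = (\<Sum>l\<in>UNIV. (x + \<alpha>) $ l *\<^sub>R axis l 1)"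
        using \<sigma> by (simp add: t_def)
      also have "\<dots> = x + \<alpha>"
        using basis_expansion[of "x + \<alpha>"] by (simp add: scalar_mult_eq_scaleR)
      finally show ?thesis by simp
    qed
    ultimately show ?thesis by simp
  qed
next
  show "simplex_vertices (simplex_Gamma *v x) = {x}" for x :: "real^'n"
    by (auto simp: simplex_vertices_def Let_def simplex_Gamma_mult vec_eq_iff sum_negf)
qed

section \<open>A feasible trajectory is a feasible degenerate tube\<close>

text \<open>Each cross section is the point \<open>xs k\<close>, and subtracting \<open>K k *v xs k\<close> from the feedforward term
  makes the feedback law return \<open>us k\<close> at that point.\<close>

lemma feasible_trajectory_imp_problem_feasible:
  assumes V: "vertex_map \<Gamma> V" and dc: "dc_form \<Gamma> (dyn S) g h"
    and Qhat: "pos_semidef (Qhat S)"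
    and feas: "feasible_trajectory S xs us"
  shows "problem_feasible S V g h xs us K"
proof -
  have V_point: "V (\<Gamma> *v x) = {x}" for x using V by (simp add: vertex_map_def)
  have "g z - taylor1 h z z = \<Gamma> *v dyn S z" for z
  proof -
    have "h differentiable (at z)"
      using dc unfolding dc_form_def differentiable_on_def by blast
    then have "linear (frechet_derivative h (at z))" by (rule linear_frechet_derivative)
    moreover have "\<Gamma> *v dyn S z = g z - h z" using dc unfolding dc_form_def by blast
    ultimately show ?thesis by (simp add: taylor1_def linear_0)
  qed
  then have "constraints S V g h xs us K
      (\<lambda>k. us k - K k *v xs k) (\<lambda>k. \<Gamma> *v xs k)
      (\<lambda>k. if k = horizon S then sqrt (gamhat S) else wnorm (Qx S) (xs k - xref S))
      (\<lambda>k. wnorm (Ru S) (us k - uref S))"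
    using feas
    by (simp add: constraints_def V_point Let_def feasible_trajectory_def wnorm_le_sqrt_iff[OF Qhat])
  then show ?thesis unfolding problem_feasible_def by blast
qed

section \<open>Feasibility of the updated trajectories\<close>

text \<open>The invariant along the response is membership in the convex hull of the vertices, because this
  is where the constraints hold; the inequalities \<open>\<Gamma> *v x \<le> q\<close> serve only to pass from
  one step to the next.\<close>

lemma constraints_imp_feasible_roll:
  assumes V: "vertex_map \<Gamma> V" and dc: "dc_form \<Gamma> (dyn S) g h"
    and X: "convex (Xset S)" and U: "convex (Uset S)"
    and Qhat: "pos_semidef (Qhat S)"
    and con: "constraints S V g h xs us K v q \<theta> \<phi>"
  shows "feasible_trajectory S (roll_states (dyn S) (tube_law v K) (xs 0))
           (roll_inputs (dyn S) (tube_law v K) (xs 0))"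
proof -
  define y where "y = roll_states (dyn S) (tube_law v K) (xs 0)"
  have y_Suc: "y (Suc k) = dyn S (y k, v k + K k *v y k)" for k
    by (simp add: y_def tube_law_def)
  have diff: "h differentiable (at z)" for z
    using dc unfolding dc_form_def differentiable_on_def by blast
  \<comment> \<open>All stage constraints on a pair of state and input that do not concern the cost bounds.\<close>
  define C where "C = (\<lambda>k. Xset S \<times> Uset S \<inter>
      {z. g z - taylor1 h (xs k, us k) z \<le> q (Suc k)})"
  have hull_C: "(x, v k + K k *v x) \<in> C k" if "k < horizon S" "x \<in> convex hull V (q k)" for k x
  proof -
    have "convex (C k)"
      unfolding C_def using dc diff
      by (intro convex_Int convex_Times X U convex_dc_sublevel) (auto simp: dc_form_def)
    moreover have "V (q k) \<subseteq> {x. (x, v k + K k *v x) \<in> C k}"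
      using con that(1) by (auto simp: constraints_def C_def Let_def)
    ultimately have "convex hull V (q k) \<subseteq> {x. (x, v k + K k *v x) \<in> C k}"
      by (intro hull_minimal convex_feedback_vimage)
    then show ?thesis using that(2) by blast
  qed
  have in_tube: "k \<le> horizon S \<Longrightarrow> y k \<in> convex hull V (q k)" for k
  proof (induction k)
    case 0
    have "V (q 0) \<noteq> {}" using V by (simp add: vertex_map_def)
    moreover have "\<forall>x\<in>V (q 0). x = xs 0" using con by (simp add: constraints_def)
    ultimately have "V (q 0) = {xs 0}" by auto
    then show ?case by (simp add: y_def)
  next
    case (Suc k)
    define z where "z = (y k, v k + K k *v y k)"
    have "z \<in> C k" unfolding z_def using Suc by (intro hull_C) auto
    then have le: "g z - taylor1 h (xs k, us k) z \<le> q (Suc k)" by (simp add: C_def)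
    have "taylor1 h (xs k, us k) z \<le> h z"
      unfolding less_eq_vec_def
      using dc diff by (auto simp: dc_form_def intro: taylor1_le_convex)
    then have "g z - h z \<le> q (Suc k)"
      using le by (meson diff_left_mono order_trans)
    then have "\<Gamma> *v y (Suc k) \<le> q (Suc k)"
      using dc by (simp add: dc_form_def y_Suc z_def)
    then show ?case using V by (simp add: vertex_map_def)
  qed
  have "V (q (horizon S)) \<subseteq> terminal_set S"
    using con by (force simp: constraints_def terminal_set_def simp flip: wnorm_le_sqrt_iff[OF Qhat])
  then have "convex hull V (q (horizon S)) \<subseteq> terminal_set S"
    using convex_terminal_set[OF Qhat] by (rule hull_minimal)
  then have "y (horizon S) \<in> terminal_set S" using in_tube by blast
  moreover have "y k \<in> Xset S \<and> v k + K k *v y k \<in> Uset S" if "k < horizon S" for k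
    using hull_C[OF that in_tube] that by (simp add: C_def)
  ultimately show ?thesis
    unfolding feasible_trajectory_def y_def[symmetric]
    by (simp add: y_Suc terminal_set_def roll_inputs_def tube_law_def flip: y_def)
qed

text \<open>Only the last step of the shifted trajectory is new. It starts in the terminal set, where the
  terminal law is admissible, and invariance keeps its end there.\<close>

lemma feasible_trajectory_shift:
  assumes "1 \<le> horizon S"
    and "terminal_set S \<subseteq> Xset S"
    and "\<forall>x\<in>terminal_set S. terminal_law S x \<in> Uset S"
    and inv: "\<And>x. x \<in> terminal_set S \<Longrightarrow> dyn S (x, terminal_law S x) \<in> terminal_set S"
    and feas: "feasible_trajectory S xs us"
  shows "feasible_trajectory S (roll_states (dyn S) (shift_law S us) (xs 1))
           (roll_inputs (dyn S) (shift_law S us) (xs 1))"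
proof -
  define y where "y = roll_states (dyn S) (shift_law S us) (xs 1)"
  have y_Suc: "y (Suc k) = dyn S (y k, shift_law S us k (y k))" for k by (simp add: y_def)
  have y: "k < horizon S \<Longrightarrow> y k = xs (Suc k)" for k
  proof (induction k)
    case 0
    then show ?case by (simp add: y_def)
  next
    case (Suc k)
    then show ?case using feas by (simp add: y_Suc shift_law_def feasible_trajectory_def)
  qed
  obtain N where N: "horizon S = Suc N" using assms(1) by (cases "horizon S") auto
  have "xs (Suc N) \<in> terminal_set S"
    using feas unfolding feasible_trajectory_def terminal_set_def N by blast
  then have last: "y N \<in> terminal_set S" using y[of N] N by simp
  have "y k \<in> Xset S \<and> shift_law S us k (y k) \<in> Uset S" if "k < horizon S" for k
  proof (cases "k = N")
    case True
    then show ?thesis using last assms(2,3) by (auto simp: shift_law_def N)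
  next
    case False
    then have "Suc k < horizon S" using that by (simp add: N)
    moreover from this have "xs (Suc k) \<in> Xset S \<and> us (Suc k) \<in> Uset S"
      using feas unfolding feasible_trajectory_def by blast
    ultimately show ?thesis using y[OF that] by (simp add: shift_law_def)
  qed
  moreover have "y (horizon S) \<in> terminal_set S"
    using inv[OF last] by (simp add: N y_Suc shift_law_def)
  moreover have "roll_inputs (dyn S) (shift_law S us) (xs 1) = (\<lambda>k. shift_law S us k (y k))"
    by (simp add: fun_eq_iff roll_inputs_def y_def)
  ultimately show ?thesis
    unfolding feasible_trajectory_def y_def[symmetric]
    by (simp add: y_Suc terminal_set_def)
qed

section \<open>Recursive feasibility\<close>

text \<open>The conjunct \<open>xs 0 = x\<close> is needed for the time step: it makes the
  undisturbed plant move to the second state of the trajectory, where the shifted one starts.\<close>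

lemma poses_feasible_trajectory:
  assumes V: "vertex_map \<Gamma> V" and dc: "dc_form \<Gamma> (dyn S) g h"
    and X: "convex (Xset S)" and U: "convex (Uset S)"
    and Qhat: "pos_semidef (Qhat S)"
    and N: "1 \<le> horizon S"
    and term_X: "terminal_set S \<subseteq> Xset S"
    and term_U: "\<forall>x\<in>terminal_set S. terminal_law S x \<in> Uset S"
    and inv: "\<And>x. x \<in> terminal_set S \<Longrightarrow> dyn S (x, terminal_law S x) \<in> terminal_set S"
    and poses: "poses S V g h tol jmax x_init n j x xs us Jp"
  shows "feasible_trajectory S xs us \<and> xs 0 = x"
  using poses
proof induction
  case (start xs us)
  then show ?case by simp
next
  case (next_iteration n j x xs us Jp K v q \<theta> \<phi> xs' us')
  have "constraints S V g h xs us K v q \<theta> \<phi>"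
    using next_iteration.hyps by (simp add: optimal_def)
  from constraints_imp_feasible_roll[OF V dc X U Qhat this]
  show ?case using next_iteration by simp
next
  case (next_time n j x xs us Jp K v q \<theta> \<phi> us' x' xs'' us'')
  define ys where "ys = roll_states (dyn S) (tube_law v K) (xs 0)"
  have "constraints S V g h xs us K v q \<theta> \<phi>"
    using next_time.hyps by (simp add: optimal_def)
  from constraints_imp_feasible_roll[OF V dc X U Qhat this]
  have "feasible_trajectory S ys us'"
    using next_time.hyps by (simp add: ys_def)
  from feasible_trajectory_shift[OF N term_X term_U inv this]
  have "feasible_trajectory S (roll_states (dyn S) (shift_law S us') (ys 1))
           (roll_inputs (dyn S) (shift_law S us') (ys 1))" .
  moreover have "ys 1 = x'"
    using next_time by (simp add: ys_def roll_inputs_def)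
  ultimately show ?case using next_time by simp
qed

theorem proposition2:
  fixes S :: "('n::finite, 'm::finite) mpc"
    and tol :: real and jmax :: nat and x_init :: "real^'n"
  assumes "dyn S differentiable_on UNIV"
    and "compact (Xset S)" "convex (Xset S)"
    and "compact (Uset S)" "convex (Uset S)"
    and "pos_semidef (Qx S)" "pos_def (Ru S)" "pos_def (Qhat S)"
    and "1 \<le> horizon S"
    and "0 < gamhat S"
    and "terminal_set S \<subseteq> Xset S"
    and "\<forall>x\<in>terminal_set S. terminal_law S x \<in> Uset S"
    and "\<forall>x\<in>terminal_set S.
           (wnorm (Qhat S) (x - xref S))\<^sup>2 \<ge>
             (wnorm (Qhat S) (dyn S (x, terminal_law S x) - xref S))\<^sup>2
             + (wnorm (Qx S) (x - xref S))\<^sup>2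
             + (wnorm (Ru S) (Khat S *v (x - xref S)))\<^sup>2"
    and "1 \<le> jmax"
    and "\<exists>xs us. feasible_trajectory S xs us \<and> xs 0 = x_init"
  shows
    "(\<forall>g h. dc_form box_Gamma (dyn S) g h \<longrightarrow>
        (\<forall>n j x xs us Jp. poses S box_vertices g h tol jmax x_init n j x xs us Jp \<longrightarrow>
           problem_feasible S box_vertices g h xs us (gain S xs us))) \<and>
     (\<forall>g h. dc_form simplex_Gamma (dyn S) g h \<longrightarrow>
        (\<forall>n j x xs us Jp. poses S simplex_vertices g h tol jmax x_init n j x xs us Jp \<longrightarrow>
           problem_feasible S simplex_vertices g h xs us (gain S xs us)))"
proof -
  have Qhat: "pos_semidef (Qhat S)" using assms(8) by (rule pos_def_imp_pos_semidef)
  \<comment> \<open>The stage costs in the terminal inequality are squares, so dropping them gives invariance.\<close>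
  have inv: "dyn S (x, terminal_law S x) \<in> terminal_set S" if x: "x \<in> terminal_set S" for x
  proof -
    have "(wnorm (Qhat S) (dyn S (x, terminal_law S x) - xref S))\<^sup>2
        \<le> (wnorm (Qhat S) (x - xref S))\<^sup>2"
      using bspec[OF assms(13) x] zero_le_power2[of "wnorm (Qx S) (x - xref S)"]
        zero_le_power2[of "wnorm (Ru S) (Khat S *v (x - xref S))"] by linarith
    then show ?thesis using x by (simp add: terminal_set_def)
  qed
  have feasible: "problem_feasible S V g h xs us (gain S xs us)"
    if "vertex_map \<Gamma> V" "dc_form \<Gamma> (dyn S) g h" "poses S V g h tol jmax x_init n j x xs us Jp"
    for \<Gamma> :: "real^'n^'r::finite" and V g h n j x xs us Jp
    using poses_feasible_trajectory[OF that(1,2) assms(3,5) Qhat assms(9,11,12) inv that(3)]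
      feasible_trajectory_imp_problem_feasible[OF that(1,2) Qhat] by blast
  show ?thesis
    using feasible[OF box_vertex_map] feasible[OF simplex_vertex_map] by blast
qed

end
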